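(* Let $\Omega=D_1(0) \subset \mathbb{R}^2$ be the open unit disc and set $u(x_1,x_2)=e^{x_1}\sin(x_2)+3$. Then $u$ is harmonic (in particular subharmonic) in $\Omega$ and $u\geq 0$ in $\Omega$, but for every $x\in\Omega$ and every $r>0$ with $\overline{D_r(x)}\subset\Omega$ the inequality $$\frac12 u(x) < \frac{1}{\pi r^2}\int_{D_r(x)} u(y) \log\frac{r}{|x-y|}\, \mathrm{d}y$$ does not hold.
   Context: $D_r(x)=\{y\in\mathbb{R}^2: |x-y|<r\}$ is the open disc of radius $r$ centered at $x$, with closure $\overline{D_r(x)}=\{y\in\mathbb{R}^2:|x-y|\le r\}$, where $|\cdot|$ is the Euclidean norm. $\Delta=\partial_{x_1}^2+\partial_{x_2}^2$ is the Laplacian; $u$ is harmonic in $\Omega$ if $\Delta u=0$ in $\Omega$ and subharmonic in $\Omega$ if $-\Delta u\le 0$ in $\Omega$. $\log$ is the natural logarithm, and the integral is with respect to Lebesgue measure. *)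

theory Defs
  imports "HOL-Analysis.Analysis"
begin

definition partial_deriv :: "2 \<Rightarrow> (real^2 \<Rightarrow> real) \<Rightarrow> real^2 \<Rightarrow> real" where
  "partial_deriv i f x = deriv (\<lambda>t. f (x + t *\<^sub>R axis i 1)) 0"

definition C1_on :: "(real^2) set \<Rightarrow> (real^2 \<Rightarrow> real) \<Rightarrow> bool" where
  "C1_on S f \<longleftrightarrow>
     (\<forall>i. (\<forall>x\<in>S. (\<lambda>t. f (x + t *\<^sub>R axis i 1)) differentiable (at 0)) \<and>
          continuous_on S (partial_deriv i f))"

definition C2_on :: "(real^2) set \<Rightarrow> (real^2 \<Rightarrow> real) \<Rightarrow> bool" where
  "C2_on S f \<longleftrightarrow> C1_on S f \<and> (\<forall>i. C1_on S (partial_deriv i f))"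

definition laplacian :: "(real^2 \<Rightarrow> real) \<Rightarrow> real^2 \<Rightarrow> real" where
  "laplacian f x =
     partial_deriv 1 (partial_deriv 1 f) x + partial_deriv 2 (partial_deriv 2 f) x"

(* C2_on is required because deriv, hence laplacian, takes an unspecified value
   where a derivative does not exist. The set S is meant to be open. *)

definition harmonic_on :: "(real^2) set \<Rightarrow> (real^2 \<Rightarrow> real) \<Rightarrow> bool" where
  "harmonic_on S f \<longleftrightarrow> C2_on S f \<and> (\<forall>x\<in>S. laplacian f x = 0)"

definition subharmonic_on :: "(real^2) set \<Rightarrow> (real^2 \<Rightarrow> real) \<Rightarrow> bool" where
  "subharmonic_on S f \<longleftrightarrow> C2_on S f \<and> (\<forall>x\<in>S. - laplacian f x \<le> 0)"

end

theory Submission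
  imports Defs
begin

text \<open>
  The strict inequality fails because its two sides are equal.  Identify the plane with the complex
  numbers, so that \<open>u x = Im (exp x) + 3\<close>, and shift the centre of the disc to the
  origin: the integrand becomes \<open>(Im (exp x * exp z) + 3) * ln (r / norm z)\<close>.  The
  logarithmic kernel is invariant under rotations about the origin.  Expand \<open>exp z\<close> into its
  power series.  Rotation by the angle \<open>pi / m\<close> turns \<open>z ^ m\<close> into its negative, so every
  monomial of positive degree has integral zero against a radial weight, and only the constant term
  survives: this is the mean value property, in the form \<open>radial_mean_value\<close>.  The integral
  therefore equals \<open>u x\<close> times the total mass of the kernel, and that mass is
  \<open>pi * r\<^sup>2 / 2\<close> (\<open>has_bochner_integral_log_weight\<close>), which after division by
  \<open>pi * r\<^sup>2\<close> leaves exactly half of \<open>u x\<close>.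

  The mass is computed by writing \<open>ln (r / norm z)\<close> as the integral of \<open>1 / s\<close> over
  \<open>norm z < s < r\<close> and exchanging the order of integration: the inner integral is then
  the area of the disc of radius \<open>s\<close>, and \<open>1 / s * (pi * s\<^sup>2)\<close> is integrated by the
  fundamental theorem of calculus.

  Nonnegativity holds since \<open>exp (x $ 1) * sin (x $ 2)\<close> is at least \<open>- exp 1 \<ge> - 3\<close>
  on the unit disc.
\<close>

section \<open>Rotations and radial weights\<close>

text \<open>
  It suffices to compare the two measures on boxes, whose orthogonal images have the same
  finite measure.  This allows rotations as substitutions in Bochner integrals.
\<close>
lemma lborel_distr_orthogonal:
  fixes T :: "real^'n::{finite,wellorder} \<Rightarrow> real^'n::_"
  assumes T: "orthogonal_transformation T"
  shows "distr lborel borel T = lborel"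
proof (rule lborel_eqI[symmetric])
  fix l u :: "real^'n::_"
  assume le: "\<And>b. b \<in> Basis \<Longrightarrow> l \<bullet> b \<le> u \<bullet> b"
  have lin: "linear T" and inv: "orthogonal_transformation (inv T)" and bij: "bij T"
    using T orthogonal_transformation_inv orthogonal_transformation_bij
    by (auto simp: orthogonal_transformation_linear)
  have meas [measurable]: "T \<in> borel_measurable lborel"
    using borel_measurable_continuous_onI[OF linear_continuous_on[OF linear_conv_bounded_linear[THEN iffD1, OF lin]]]
    by simp
  have eq: "T -` box l u = inv T ` box l u"
    using bij by (rule bij_vimage_eq_inv_image)
  have fm: "inv T ` box l u \<in> lmeasurable"
    using inv by (rule measurable_orthogonal_image) auto
  have borel: "T -` box l u \<in> sets borel"
    using measurable_sets_borel[of T borel "box l u"] meas by simp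
  have "emeasure (distr lborel borel T) (box l u) = emeasure lborel (T -` box l u)"
    by (simp add: emeasure_distr)
  also have "\<dots> = emeasure lebesgue (inv T ` box l u)"
    using borel by (simp add: eq)
  also have "\<dots> = ennreal (measure lebesgue (inv T ` box l u))"
    using fm by (simp add: emeasure_eq_measure2)
  also have "\<dots> = ennreal (measure lebesgue (box l u))"
    using measure_orthogonal_image[OF inv, of "box l u"] by simp
  also have "\<dots> = ennreal (\<Prod>b\<in>Basis. (u - l) \<bullet> b)"
    using le by (simp add: measure_lborel_box)
  finally show "emeasure (distr lborel borel T) (box l u) = ennreal (\<Prod>b\<in>Basis. (u - l) \<bullet> b)" .
qed simp

definition to_complex :: "real^2 \<Rightarrow> complex" where
  "to_complex z = Complex (z $ 1) (z $ 2)"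

definition complex_mult :: "complex \<Rightarrow> real^2 \<Rightarrow> real^2" where
  "complex_mult c z = vector [Re c * z $ 1 - Im c * z $ 2, Re c * z $ 2 + Im c * z $ 1]"

lemma to_complex_mult: "to_complex (complex_mult c z) = c * to_complex z"
  by (simp add: to_complex_def complex_mult_def complex_eq_iff)

lemma to_complex_add: "to_complex (x + z) = to_complex x + to_complex z"
  by (simp add: to_complex_def complex_eq_iff)

lemma norm_to_complex: "norm (to_complex z) = norm z"
  by (simp add: to_complex_def cmod_def norm_vec_def L2_set_def sum_2)

lemma to_complex_measurable [measurable]: "to_complex \<in> borel_measurable borel"
  unfolding to_complex_def Complex_eq
  by (intro borel_measurable_continuous_onI continuous_intros)

lemma orthogonal_complex_mult:
  assumes "norm c = 1"
  shows "orthogonal_transformation (complex_mult c)"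
  unfolding orthogonal_transformation
proof
  show "linear (complex_mult c)"
    by (rule linearI) (simp_all add: complex_mult_def vec_eq_iff forall_2 algebra_simps)
  show "\<forall>v. norm (complex_mult c v) = norm v"
    by (metis to_complex_mult norm_to_complex norm_mult assms mult_1)
qed

text \<open>
  The rotation by the angle \<open>pi / m\<close> preserves the measure and the weight and changes the sign of
  the monomial, so the integral equals its own negative.
\<close>
lemma integral_radial_monomial:
  fixes w :: "real \<Rightarrow> real"
  assumes [measurable]: "w \<in> borel_measurable borel" and m: "m \<noteq> 0"
  shows "(\<integral>z. w (norm z) *\<^sub>R to_complex z ^ m \<partial>lborel) = 0"
proof -
  define c where "c = cis (pi / m)"
  have c: "norm c = 1" "c ^ m = - 1"
    using m by (auto simp: c_def Complex.DeMoivre cis_pi)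
  let ?f = "\<lambda>z. w (norm z) *\<^sub>R to_complex z ^ m"
  note T = orthogonal_complex_mult[OF c(1)]
  have meas [measurable]: "complex_mult c \<in> borel_measurable borel"
    by (rule borel_measurable_continuous_onI linear_continuous_on
        linear_conv_bounded_linear[THEN iffD1] orthogonal_transformation_linear[OF T])+
  have "integral\<^sup>L lborel ?f = integral\<^sup>L (distr lborel borel (complex_mult c)) ?f"
    by (simp add: lborel_distr_orthogonal[OF T])
  also have "\<dots> = (\<integral>z. ?f (complex_mult c z) \<partial>lborel)"
    by (rule integral_distr) measurable
  also have "\<dots> = (\<integral>z. - ?f z \<partial>lborel)"
    using T by (simp add: to_complex_mult power_mult_distrib c orthogonal_transformation)
  finally show ?thesis
    by simp
qed

text \<open>
  The mean value property of a power series with respect to a radial weight.  The weight vanishes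
  beyond the radius \<open>r\<close>, at which the series converges absolutely; hence the terms are dominated
  by \<open>norm (a n) * r ^ n\<close> times the weight, integration may be done term by term, and only the
  term \<open>n = 0\<close> contributes.
\<close>
lemma radial_mean_value:
  fixes w :: "real \<Rightarrow> real" and a :: "nat \<Rightarrow> complex"
  assumes [measurable]: "w \<in> borel_measurable borel"
    and int: "integrable lborel (\<lambda>z::real^2. w (norm z))"
    and supp: "\<And>s. s > r \<Longrightarrow> w s = 0"
    and sum: "summable (\<lambda>n. norm (a n) * r ^ n)"
  shows "has_bochner_integral lborel (\<lambda>z. w (norm z) *\<^sub>R (\<Sum>n. a n * to_complex z ^ n))
           (a 0 * (\<integral>z. w (norm (z::real^2)) \<partial>lborel))"
proof -
  let ?t = "\<lambda>n z. w (norm z) *\<^sub>R (a n * to_complex z ^ n)"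
  have bound: "norm (?t n z) \<le> norm (a n) * r ^ n * \<bar>w (norm z)\<bar>" for n z
  proof (cases "norm z \<le> r")
    case True
    have "norm (?t n z) = norm (a n) * norm z ^ n * \<bar>w (norm z)\<bar>"
      by (simp add: norm_mult norm_power norm_to_complex)
    also have "\<dots> \<le> norm (a n) * r ^ n * \<bar>w (norm z)\<bar>"
      using True by (intro mult_right_mono mult_left_mono power_mono) auto
    finally show ?thesis .
  qed (simp add: supp)
  have int_bound: "integrable lborel (\<lambda>z::real^2. norm (a n) * r ^ n * \<bar>w (norm z)\<bar>)" for n
    using int by (intro integrable_mult_right integrable_abs)
  have int_t: "integrable lborel (?t n)" for n
  proof (rule Bochner_Integration.integrable_bound[OF int_bound])
    show "AE z in lborel. norm (?t n z) \<le> norm (norm (a n) * r ^ n * \<bar>w (norm z)\<bar>)"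
      using order_trans[OF bound abs_ge_self] by (intro always_eventually allI) simp
  qed measurable
  have summ: "summable (\<lambda>n. norm (?t n z))" for z
    by (rule summable_comparison_test'[where g = "\<lambda>n. norm (a n) * r ^ n * \<bar>w (norm z)\<bar>"])
      (use bound sum in \<open>auto intro: summable_mult2\<close>)
  have summ_int: "summable (\<lambda>n. \<integral>z. norm (?t n z) \<partial>lborel)"
  proof (rule summable_comparison_test')
    show "summable (\<lambda>n. norm (a n) * r ^ n * (\<integral>z. \<bar>w (norm (z::real^2))\<bar> \<partial>lborel))"
      using sum by (rule summable_mult2)
    show "norm (\<integral>z. norm (?t n z) \<partial>lborel) \<le> norm (a n) * r ^ n * (\<integral>z. \<bar>w (norm (z::real^2))\<bar> \<partial>lborel)" for n
    proof -
      have "(\<integral>z. norm (?t n z) \<partial>lborel) \<le> (\<integral>z. norm (a n) * r ^ n * \<bar>w (norm (z::real^2))\<bar> \<partial>lborel)"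
        using int_t int_bound bound by (intro integral_mono integrable_norm)
      then show ?thesis
        by simp
    qed
  qed
  have lim: "(\<Sum>n. ?t n z) = w (norm z) *\<^sub>R (\<Sum>n. a n * to_complex z ^ n)" for z
  proof (cases "w (norm z) = 0")
    case False
    have "summable (\<lambda>n. ?t n z)"
      using summ by (rule summable_norm_cancel)
    then have "summable (\<lambda>n. inverse (w (norm z)) *\<^sub>R ?t n z)"
      by (rule summable_scaleR_right)
    with False have "summable (\<lambda>n. a n * to_complex z ^ n)"
      by simp
    then show ?thesis
      by (rule suminf_scaleR_right[symmetric])
  qed simp
  have monomial: "(\<integral>z. ?t n z \<partial>lborel) = (if n = 0 then a 0 * (\<integral>z. w (norm (z::real^2)) \<partial>lborel) else 0)" for n
  proof -
    have "?t n = (\<lambda>z. a n * (w (norm z) *\<^sub>R to_complex z ^ n))"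
      by (simp add: fun_eq_iff)
    then show ?thesis
      using integral_radial_monomial[of w n] by (cases "n = 0") (simp_all add: scaleR_conv_of_real)
  qed
  have "(\<lambda>n. \<integral>z. ?t n z \<partial>lborel) sums (a 0 * (\<integral>z. w (norm (z::real^2)) \<partial>lborel))"
    unfolding monomial using sums_single[of 0 "\<lambda>_. a 0 * (\<integral>z. w (norm (z::real^2)) \<partial>lborel)"]
    by simp
  moreover have "(\<lambda>n. \<integral>z. ?t n z \<partial>lborel) sums (\<integral>z. (\<Sum>n. ?t n z) \<partial>lborel)"
    using int_t summ summ_int by (intro sums_integral) auto
  ultimately have "(\<integral>z. (\<Sum>n. ?t n z) \<partial>lborel) = a 0 * (\<integral>z. w (norm (z::real^2)) \<partial>lborel)"
    using sums_unique2 by blast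
  moreover have "integrable lborel (\<lambda>z. \<Sum>n. ?t n z)"
    using int_t summ summ_int by (intro integrable_suminf) auto
  ultimately show ?thesis
    unfolding lim has_bochner_integral_iff by simp
qed

section \<open>The logarithmic kernel of a disc\<close>

text \<open>
  As a function of \<open>norm z\<close>, this is \<open>2 * pi\<close> times the Green function of the disc of radius
  \<open>r\<close> with pole at the centre, extended by zero.  At the pole itself the value is
  \<open>ln (r / 0) = 0\<close>, in agreement with \<open>ln (r / norm (x - y))\<close> for \<open>y = x\<close>.
\<close>
definition log_weight :: "real \<Rightarrow> real \<Rightarrow> real" where
  "log_weight r s = (if s < r then ln (r / s) else 0)"

lemma log_weight_measurable [measurable]: "log_weight r \<in> borel_measurable borel"
  unfolding log_weight_def by measurable

text \<open>
  By Tonelli's theorem, slicing the kernel into discs: a disc of radius \<open>s\<close> enters with density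
  \<open>1 / s\<close>.  Since the kernel is nonnegative, the finite value also gives integrability.
\<close>
lemma has_bochner_integral_log_weight:
  assumes r: "r > 0"
  shows "has_bochner_integral lborel (\<lambda>z::real^2. log_weight r (norm z)) (pi * r\<^sup>2 / 2)"
proof -
  let ?k = "\<lambda>(z::real^2) s. ennreal (1 / s) * indicator {0<..r} s * indicator (ball 0 s) z"
  \<comment> \<open>The slicing fails at the origin, where \<open>1 / s\<close> is not integrable, but a point is negligible.\<close>
  have slice: "(\<integral>\<^sup>+s. ?k z s \<partial>lborel) = ennreal (log_weight r (norm z))" if "z \<noteq> 0" for z
  proof (cases "norm z < r")
    case True
    have pos: "0 < s" if "norm z \<le> s" for s
      using that \<open>z \<noteq> 0\<close> by (metis zero_less_norm_iff order.strict_trans2)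
    have "(\<integral>\<^sup>+s. ?k z s \<partial>lborel) = (\<integral>\<^sup>+s. ennreal (1 / s) * indicator {norm z..r} s \<partial>lborel)"
    proof (rule nn_integral_cong_AE)
      have "AE s in lborel. s \<noteq> norm z"
        by (rule AE_lborel_singleton)
      then show "AE s in lborel. ?k z s = ennreal (1 / s) * indicator {norm z..r} s"
        by eventually_elim (auto split: split_indicator dest: pos)
    qed
    also have "\<dots> = ennreal (ln r - ln (norm z))"
      using that True
      by (intro nn_integral_FTC_Icc) (auto intro!: derivative_eq_intros intro: pos less_imp_le)
    finally show ?thesis
      using that True r by (simp add: log_weight_def ln_div)
  next
    case False
    then have "?k z = (\<lambda>s. 0)"
      by (auto simp: fun_eq_iff split: split_indicator)
    with False show ?thesis
      by (simp add: log_weight_def)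
  qed
  have nonneg: "0 \<le> log_weight r (norm z)" for z :: "real^2"
    by (cases "z = 0") (auto simp: log_weight_def)
  have [measurable]: "Measurable.pred (borel \<Otimes>\<^sub>M borel) (\<lambda>p::(real^2)\<times>real. norm (fst p) < snd p)"
    by measurable
  have ball_ind: "indicator (ball 0 s) z = (if norm z < s then 1 else (0::ennreal))" for z :: "real^2" and s
    by (simp add: indicator_def)
  have "(\<integral>\<^sup>+z. ennreal (log_weight r (norm (z::real^2))) \<partial>lborel) = (\<integral>\<^sup>+z. \<integral>\<^sup>+s. ?k z s \<partial>lborel \<partial>lborel)"
  proof (rule nn_integral_cong_AE)
    have "AE z::real^2 in lborel. z \<noteq> 0"
      by (rule AE_lborel_singleton)
    then show "AE z::real^2 in lborel. ennreal (log_weight r (norm z)) = (\<integral>\<^sup>+s. ?k z s \<partial>lborel)"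
      by eventually_elim (simp add: slice)
  qed
  also have "\<dots> = (\<integral>\<^sup>+s. \<integral>\<^sup>+z. ?k z s \<partial>lborel \<partial>lborel)"
    unfolding ball_ind by (rule lborel_pair.Fubini'[symmetric]) measurable
  also have "\<dots> = (\<integral>\<^sup>+s. ennreal (pi * s) * indicator {0..r} s \<partial>lborel)"
  proof (rule nn_integral_cong)
    fix s :: real
    show "(\<integral>\<^sup>+z. ?k z s \<partial>lborel) = ennreal (pi * s) * indicator {0..r} s"
    proof (cases "0 < s \<and> s \<le> r")
      case True
      then have "(\<integral>\<^sup>+z. ?k z s \<partial>lborel) = ennreal (1 / s) * emeasure lborel (ball (0::real^2) s)"
        by (simp add: nn_integral_cmult_indicator)
      also have "\<dots> = ennreal (1 / s) * ennreal (pi * s\<^sup>2)"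
        using True by (simp add: emeasure_ball unit_ball_vol_2)
      also have "\<dots> = ennreal (pi * s)"
        using True by (simp flip: ennreal_mult add: power2_eq_square)
      finally show ?thesis
        using True by simp
    qed (auto split: split_indicator)
  qed
  also have "\<dots> = ennreal (pi * r\<^sup>2 / 2 - pi * 0\<^sup>2 / 2)"
    using r by (intro nn_integral_FTC_Icc) (auto intro!: derivative_eq_intros)
  finally have "(\<integral>\<^sup>+z. ennreal (log_weight r (norm (z::real^2))) \<partial>lborel) = ennreal (pi * r\<^sup>2 / 2)"
    by simp
  then show ?thesis
    using nonneg by (intro has_bochner_integral_nn_integral) auto
qed

text \<open>
  The factor \<open>exp (to_complex x)\<close> is constant in \<open>z\<close>, so that it is enough to apply the mean value
  property to the exponential series at the origin.
\<close>
lemma has_bochner_integral_log_weight_Im_exp: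
  assumes r: "r > 0"
  shows "has_bochner_integral lborel
           (\<lambda>z. log_weight r (norm z) * (Im (exp (to_complex (x + z))) + c))
           (pi * r\<^sup>2 / 2 * (Im (exp (to_complex x)) + c))"
proof -
  note W = has_bochner_integral_log_weight[OF r]
  have exp_series: "(\<Sum>n. inverse (fact n) * y ^ n) = exp y" for y :: complex
    by (simp add: exp_def scaleR_conv_of_real)
  have supp: "log_weight r s = 0" if "s > r" for s
    using that by (simp add: log_weight_def)
  have summ: "summable (\<lambda>n. norm (inverse (fact n) :: complex) * r ^ n)"
    using summable_exp[of r] by (simp add: norm_inverse)
  have "has_bochner_integral lborel (\<lambda>z. log_weight r (norm z) *\<^sub>R exp (to_complex z)) (of_real (pi * r\<^sup>2 / 2))"
    using radial_mean_value[OF log_weight_measurable integrable.intros[OF W] supp summ]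
      has_bochner_integral_integral_eq[OF W] by (simp add: exp_series)
  from has_bochner_integral_Im[OF has_bochner_integral_mult_right[OF this, of "exp (to_complex x)"]]
  have "has_bochner_integral lborel (\<lambda>z. log_weight r (norm z) * Im (exp (to_complex (x + z))))
      (pi * r\<^sup>2 / 2 * Im (exp (to_complex x)))"
    by (simp add: to_complex_add exp_add scaleR_conv_of_real algebra_simps)
  from has_bochner_integral_add[OF this has_bochner_integral_mult_left[OF W, of c]]
  show ?thesis
    by (simp add: distrib_left mult.commute[of c] flip: add_divide_distrib)
qed

section \<open>Harmonicity\<close>

lemma partial_deriv_eqI:
  assumes "\<And>x. ((\<lambda>t. f (x + t *\<^sub>R axis i 1)) has_real_derivative D x) (at 0)"
  shows "partial_deriv i f = D"
  unfolding partial_deriv_def using assms by (intro ext DERIV_imp_deriv)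

lemma C1_onI:
  assumes "\<And>i x. ((\<lambda>t. f (x + t *\<^sub>R axis i 1)) has_real_derivative D i x) (at 0)"
    and "\<And>i. continuous_on S (D i)"
  shows "C1_on S f"
  unfolding C1_on_def using assms partial_deriv_eqI[OF assms(1)]
  by (auto simp: real_differentiable_def)

text \<open>
  Both partial derivatives stay within one family of functions: with the phase \<open>b\<close> as a parameter,
  differentiation in the first direction changes nothing, and in the second direction it advances
  the phase by \<open>pi / 2\<close>.  All derivatives up to second order are thereby covered at once, and two
  steps in the second direction reverse the sign.
\<close>
lemma partial_has_derivative_exp_sin:
  "((\<lambda>t. exp ((x + t *\<^sub>R axis i 1) $ 1) * sin ((x + t *\<^sub>R axis i 1) $ 2 + b) + c)
     has_real_derivative exp (x $ 1) * sin (x $ 2 + (if i = 1 then b else b + pi / 2))) (at 0)"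
  for x :: "real^2"
proof -
  have shift: "sin (y + (b + pi / 2)) = cos (y + b)" for y
    using sin_add[of "y + b" "pi / 2"] by (simp add: add.assoc)
  show ?thesis
    using exhaust_2[of i] by (auto simp: axis_def shift intro!: derivative_eq_intros)
qed

lemma harmonic_on_exp_sin: "harmonic_on S (\<lambda>x. exp (x $ 1) * sin (x $ 2) + c)"
proof -
  let ?u = "\<lambda>b c (x::real^2). exp (x $ 1) * sin (x $ 2 + b) + c"
  have pd: "partial_deriv i (?u b c) = ?u (if i = 1 then b else b + pi / 2) 0" for i b c
    using partial_has_derivative_exp_sin by (intro partial_deriv_eqI) simp
  have C1: "C1_on S (?u b c)" for b c
    by (rule C1_onI[OF partial_has_derivative_exp_sin]) (intro continuous_intros)
  have "harmonic_on S (?u 0 c)"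
    unfolding harmonic_on_def C2_on_def laplacian_def pd
    by (intro conjI allI ballI C1) (simp add: sin_add)
  then show ?thesis
    by simp
qed

lemma harmonic_on_imp_subharmonic_on: "harmonic_on S f \<Longrightarrow> subharmonic_on S f"
  by (simp add: harmonic_on_def subharmonic_on_def)

section \<open>Equality in the logarithmic mean\<close>

lemma exp_sin_eq_Im_exp: "exp (x $ 1) * sin (x $ 2) = Im (exp (to_complex x))"
  by (simp add: to_complex_def Im_exp)

theorem corollary3:
  fixes \<Omega> :: "(real^2) set" and u :: "real^2 \<Rightarrow> real"
  assumes "\<Omega> = ball 0 1"
    and "u = (\<lambda>x. exp (x $ 1) * sin (x $ 2) + 3)"
  shows "harmonic_on \<Omega> u \<and> subharmonic_on \<Omega> u \<and> (\<forall>x\<in>\<Omega>. u x \<ge> 0) \<and>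
    (\<forall>x\<in>\<Omega>. \<forall>r>0. cball x r \<subseteq> \<Omega> \<longrightarrow>
       set_integrable lebesgue (ball x r) (\<lambda>y. u y * ln (r / norm (x - y))) \<and>
       \<not> (1 / 2 * u x <
           1 / (pi * r\<^sup>2) * (LINT y:ball x r|lebesgue. u y * ln (r / norm (x - y)))))"
proof (intro conjI ballI allI impI)
  show harm: "harmonic_on \<Omega> u"
    unfolding assms by (rule harmonic_on_exp_sin)
  then show "subharmonic_on \<Omega> u"
    by (rule harmonic_on_imp_subharmonic_on)
  show "0 \<le> u x" if "x \<in> \<Omega>" for x
  proof -
    have "x $ 1 \<le> 1"
      using that component_le_norm_cart[of x 1] by (simp add: assms)
    then have "exp (x $ 1) \<le> 3"
      using exp_le by (meson exp_le_cancel_iff order_trans)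
    moreover have "\<bar>exp (x $ 1) * sin (x $ 2)\<bar> \<le> exp (x $ 1) * 1"
      unfolding abs_mult by (intro mult_mono) auto
    ultimately show ?thesis
      unfolding assms by linarith
  qed
next
  fix x r assume r: "r > (0::real)"
  define F where "F y = log_weight r (norm (y - x)) * u y" for y
  have u: "u y = Im (exp (to_complex y)) + 3" for y
    by (simp add: assms exp_sin_eq_Im_exp)
  have [measurable]: "F \<in> borel_measurable borel"
    unfolding F_def u by measurable
  have F_eq: "(\<lambda>y. indicator (ball x r) y *\<^sub>R (u y * ln (r / norm (x - y)))) = F"
    by (auto simp: fun_eq_iff F_def log_weight_def dist_norm norm_minus_commute split: split_indicator)
  have "has_bochner_integral lborel (\<lambda>z. F (x + z)) (pi * r\<^sup>2 / 2 * u x)"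
    unfolding F_def u using has_bochner_integral_log_weight_Im_exp[OF r] by simp
  then have "has_bochner_integral (distr lborel borel ((+) x)) F (pi * r\<^sup>2 / 2 * u x)"
    by (simp add: has_bochner_integral_iff integrable_distr_eq integral_distr)
  then have "has_bochner_integral lebesgue F (pi * r\<^sup>2 / 2 * u x)"
    by (simp add: lborel_distr_plus has_bochner_integral_iff integrable_completion integral_completion)
  then have int: "integrable lebesgue F" "integral\<^sup>L lebesgue F = pi * r\<^sup>2 / 2 * u x"
    by (auto simp: has_bochner_integral_iff)
  show "set_integrable lebesgue (ball x r) (\<lambda>y. u y * ln (r / norm (x - y)))"
    unfolding set_integrable_def F_eq by (rule int)
  show "\<not> (1 / 2 * u x < 1 / (pi * r\<^sup>2) * (LINT y:ball x r|lebesgue. u y * ln (r / norm (x - y))))"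
    unfolding set_lebesgue_integral_def F_eq int using r by simp
qed

end
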